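(* Let $J$ be a measurable range function with $\dim J(\omega)<\infty$ for a.e. $\omega\in[0,1)^d$, and let $R$ be a bounded measurable range operator on $J$ with $R(\omega):J(\omega)\to J(\omega)$. Let $\Sigma(\omega)=\{\lambda\in\mathbb{C}:\lambda\text{ is an eigenvalue of }R(\omega)\}$, let $A_n=\{\omega\in[0,1)^d:\dim J(\omega)=n\}$ for $n\ge 0$, and let $A_{n,i}=\{\omega\in A_n:\#\Sigma(\omega)=i\}$. Then there exist functions $\lambda_j\in L^\infty([0,1)^d)$, $j\in\mathbb{N}$, such that (i) $\lambda_j(\omega)\neq\lambda_{j'}(\omega)$ for $j\ne j'$ and for a.e. $\omega\in[0,1)^d$; (ii) $\Sigma(\omega)=\{\lambda_1(\omega),\dots,\lambda_i(\omega)\}$ for a.e. $\omega\in A_{n,i}$ and for every $i\le n$, $i,n\in\mathbb{N}$.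
   Context: A range function is a map $J$ from $[0,1)^d$ to the closed subspaces of $\ell^2(\mathbb{Z}^d)$; it is measurable if $\omega\mapsto\langle P_{J(\omega)}u,v\rangle$ is measurable for all $u,v\in\ell^2(\mathbb{Z}^d)$, where $P_{J(\omega)}$ is the orthogonal projection onto $J(\omega)$. A range operator on $J$ assigns to a.e. $\omega\in[0,1)^d$ a bounded linear operator $R(\omega)$ with domain $J(\omega)$; it is measurable if $\omega\mapsto\langle R(\omega)P_{J(\omega)}u,v\rangle$ is measurable for all $u,v\in\ell^2(\mathbb{Z}^d)$, and bounded if $\operatorname{ess\,sup}_{\omega\in[0,1)^d}\|R(\omega)\|<\infty$. Here $\mathbb{N}=\{1,2,\dots\}$. *)

theory Defs
  imports "HOL-Analysis.Analysis"
begin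

section \<open>The complex Hilbert space of square-summable families\<close>

typedef 'a ell2 = "{f :: 'a \<Rightarrow> complex. (\<lambda>k. (cmod (f k))\<^sup>2) summable_on UNIV}"
  morphisms ell2_apply Abs_ell2
  by (rule exI[of _ "\<lambda>_. 0"]) simp

lemma ell2_apply_summable: "(\<lambda>k. (cmod (ell2_apply x k))\<^sup>2) summable_on UNIV"
  using ell2_apply[of x] by simp

lemma ell2_eqI: "(\<And>k. ell2_apply x k = ell2_apply y k) \<Longrightarrow> x = y"
  by (metis ell2_apply_inject ext)

lemma square_summable_add:
  assumes "(\<lambda>k. (cmod (f k))\<^sup>2) summable_on UNIV" "(\<lambda>k. (cmod (g k))\<^sup>2) summable_on UNIV"
  shows "(\<lambda>k. (cmod (f k + g k))\<^sup>2) summable_on UNIV"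
proof (rule summable_on_comparison_test)
  show "(\<lambda>k. 2 * ((cmod (f k))\<^sup>2 + (cmod (g k))\<^sup>2)) summable_on UNIV"
    by (intro summable_on_cmult_right summable_on_add assms)
  fix k
  have "(cmod (f k + g k))\<^sup>2 \<le> (cmod (f k) + cmod (g k))\<^sup>2"
    by (intro power_mono norm_triangle_ineq) simp
  also have "\<dots> \<le> 2 * ((cmod (f k))\<^sup>2 + (cmod (g k))\<^sup>2)"
    using sum_squares_bound[of "cmod (f k)" "cmod (g k)"] by (simp add: power2_sum)
  finally show "(cmod (f k + g k))\<^sup>2 \<le> 2 * ((cmod (f k))\<^sup>2 + (cmod (g k))\<^sup>2)" .
qed simp

lemma square_summable_mult:
  assumes "(\<lambda>k. (cmod (f k))\<^sup>2) summable_on UNIV"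
  shows "(\<lambda>k. (cmod (c * f k))\<^sup>2) summable_on UNIV"
  using summable_on_cmult_right[OF assms, of "(cmod c)\<^sup>2"]
  by (simp add: norm_mult power_mult_distrib)

lemma ell2_product_summable:
  "(\<lambda>k. ell2_apply x k * cnj (ell2_apply y k)) summable_on UNIV"
proof (rule abs_summable_summable, rule summable_on_comparison_test)
  show "(\<lambda>k. (cmod (ell2_apply x k))\<^sup>2 + (cmod (ell2_apply y k))\<^sup>2) summable_on UNIV"
    by (intro summable_on_add ell2_apply_summable)
  fix k
  have "2 * (cmod (ell2_apply x k) * cmod (ell2_apply y k))
      \<le> (cmod (ell2_apply x k))\<^sup>2 + (cmod (ell2_apply y k))\<^sup>2"
    using sum_squares_bound[of "cmod (ell2_apply x k)" "cmod (ell2_apply y k)"]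
    by (simp add: algebra_simps)
  moreover have "0 \<le> cmod (ell2_apply x k) * cmod (ell2_apply y k)" by simp
  ultimately show "norm (ell2_apply x k * cnj (ell2_apply y k))
      \<le> (cmod (ell2_apply x k))\<^sup>2 + (cmod (ell2_apply y k))\<^sup>2"
    unfolding norm_mult complex_mod_cnj by linarith
qed simp

definition scaleC :: "complex \<Rightarrow> 'a ell2 \<Rightarrow> 'a ell2" (infixr "*\<^sub>C" 75)
  where "c *\<^sub>C x = Abs_ell2 (\<lambda>k. c * ell2_apply x k)"

definition cinner :: "'a ell2 \<Rightarrow> 'a ell2 \<Rightarrow> complex"
  where "cinner x y = (\<Sum>\<^sub>\<infinity>k. ell2_apply x k * cnj (ell2_apply y k))"

text \<open>The real inner product is the real part of \<^const>\<open>cinner\<close>; it induces the same norm and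
  gives access to the library's notions of norm and topology.\<close>

instantiation ell2 :: (type) real_inner
begin

definition zero_ell2 :: "'a ell2" where "0 = Abs_ell2 (\<lambda>_. 0)"

definition plus_ell2 :: "'a ell2 \<Rightarrow> 'a ell2 \<Rightarrow> 'a ell2"
  where "x + y = Abs_ell2 (\<lambda>k. ell2_apply x k + ell2_apply y k)"

definition uminus_ell2 :: "'a ell2 \<Rightarrow> 'a ell2"
  where "- x = Abs_ell2 (\<lambda>k. - ell2_apply x k)"

definition minus_ell2 :: "'a ell2 \<Rightarrow> 'a ell2 \<Rightarrow> 'a ell2"
  where "x - y = x + (- y)" for x y :: "'a ell2"

definition scaleR_ell2 :: "real \<Rightarrow> 'a ell2 \<Rightarrow> 'a ell2"
  where "scaleR r x = complex_of_real r *\<^sub>C x"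

definition inner_ell2 :: "'a ell2 \<Rightarrow> 'a ell2 \<Rightarrow> real"
  where "inner x y = Re (cinner x y)"

definition norm_ell2 :: "'a ell2 \<Rightarrow> real"
  where "norm x = sqrt (\<Sum>\<^sub>\<infinity>k. (cmod (ell2_apply x k))\<^sup>2)"

definition dist_ell2 :: "'a ell2 \<Rightarrow> 'a ell2 \<Rightarrow> real"
  where "dist x y = norm (x - y)" for x y :: "'a ell2"

definition sgn_ell2 :: "'a ell2 \<Rightarrow> 'a ell2"
  where "sgn x = scaleR (inverse (norm x)) x" for x :: "'a ell2"

definition uniformity_ell2 :: "('a ell2 \<times> 'a ell2) filter"
  where "uniformity_ell2 = (INF e\<in>{0<..}. principal {(x, y). dist x y < e})"

definition open_ell2 :: "'a ell2 set \<Rightarrow> bool"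
  where "open_ell2 U = (\<forall>x\<in>U. eventually (\<lambda>(x', y). x' = x \<longrightarrow> y \<in> U) uniformity)"

lemma ell2_apply_zero [simp]: "ell2_apply 0 k = 0"
  by (simp add: zero_ell2_def Abs_ell2_inverse)

lemma ell2_apply_plus [simp]: "ell2_apply (x + y) k = ell2_apply x k + ell2_apply y k"
  by (simp add: plus_ell2_def Abs_ell2_inverse square_summable_add ell2_apply_summable)

lemma ell2_apply_uminus [simp]: "ell2_apply (- x) k = - ell2_apply x k"
  by (simp add: uminus_ell2_def Abs_ell2_inverse ell2_apply_summable)

lemma ell2_apply_minus [simp]: "ell2_apply (x - y) k = ell2_apply x k - ell2_apply y k"
  by (simp add: minus_ell2_def)

lemma ell2_apply_scaleC [simp]: "ell2_apply (c *\<^sub>C x) k = c * ell2_apply x k"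
  by (simp add: scaleC_def Abs_ell2_inverse square_summable_mult ell2_apply_summable)

lemma ell2_apply_scaleR [simp]: "ell2_apply (scaleR r x) k = complex_of_real r * ell2_apply x k"
  by (simp add: scaleR_ell2_def)

lemma cinner_self: "cinner x x = complex_of_real (\<Sum>\<^sub>\<infinity>k. (cmod (ell2_apply x k))\<^sup>2)"
proof -
  have "cinner x x = (\<Sum>\<^sub>\<infinity>k. complex_of_real ((cmod (ell2_apply x k))\<^sup>2))"
    unfolding cinner_def complex_norm_square ..
  also have "\<dots> = complex_of_real (\<Sum>\<^sub>\<infinity>k. (cmod (ell2_apply x k))\<^sup>2)"
    by (rule infsumI) (intro has_sum_of_real has_sum_infsum ell2_apply_summable)
  finally show ?thesis .
qed

instance
proof
  fix x y z :: "'a ell2" and r s :: real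
  show "x + y + z = x + (y + z)" "x + y = y + x" "0 + x = x" "- x + x = 0" "x - y = x + - y"
    by (rule ell2_eqI, simp)+
  show "scaleR r (x + y) = scaleR r x + scaleR r y" "scaleR (r + s) x = scaleR r x + scaleR s x"
    "scaleR r (scaleR s x) = scaleR (r * s) x" "scaleR 1 x = x"
    by (rule ell2_eqI, simp add: algebra_simps)+
  show "dist x y = norm (x - y)" by (rule dist_ell2_def)
  show "sgn x = scaleR (inverse (norm x)) x" by (rule sgn_ell2_def)
  show "uniformity = (INF e\<in>{0<..}. principal {(x :: 'a ell2, y). dist x y < e})"
    by (rule uniformity_ell2_def)
  show "open U = (\<forall>x\<in>U. eventually (\<lambda>(x', y). x' = x \<longrightarrow> y \<in> U) uniformity)" for U :: "'a ell2 set"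
    by (rule open_ell2_def)
  have "cinner y x = cnj (cinner x y)"
    unfolding cinner_def infsum_cnj[symmetric] by (simp add: mult.commute)
  then show "inner x y = inner y x" by (simp add: inner_ell2_def)
  have "cinner (x + y) z = cinner x z + cinner y z"
    unfolding cinner_def
    by (simp add: distrib_right infsum_add ell2_product_summable)
  then show "inner (x + y) z = inner x z + inner y z" by (simp add: inner_ell2_def)
  have "cinner (scaleR r x) y = complex_of_real r * cinner x y"
    unfolding cinner_def by (simp add: mult.assoc infsum_cmult_right')
  then show "inner (scaleR r x) y = r * inner x y" by (simp add: inner_ell2_def)
  have inner_self: "inner x x = (\<Sum>\<^sub>\<infinity>k. (cmod (ell2_apply x k))\<^sup>2)"
    by (simp add: inner_ell2_def cinner_self)
  show "0 \<le> inner x x" unfolding inner_self by (rule infsum_nonneg) simp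
  show "inner x x = 0 \<longleftrightarrow> x = 0"
  proof
    assume "inner x x = 0"
    then have "(cmod (ell2_apply x k))\<^sup>2 = 0" for k
      unfolding inner_self
      by (intro nonneg_infsum_le_0D[of "\<lambda>k. (cmod (ell2_apply x k))\<^sup>2" UNIV])
        (auto simp: ell2_apply_summable)
    then show "x = 0" by (intro ell2_eqI) simp
  next
    assume "x = 0"
    then show "inner x x = 0" unfolding inner_self by simp
  qed
  show "norm x = sqrt (inner x x)" by (simp add: inner_self norm_ell2_def)
qed

end

global_interpretation ell2: vector_space "scaleC :: complex \<Rightarrow> 'a ell2 \<Rightarrow> 'a ell2"
  by unfold_locales (rule ell2_eqI, simp add: algebra_simps)+


section \<open>Subspaces, projections and operators on subspaces\<close>

definition closed_subspace :: "'a ell2 set \<Rightarrow> bool"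
  where "closed_subspace V \<longleftrightarrow> ell2.subspace V \<and> closed V"

text \<open>\<^term>\<open>ell2.dim V\<close> is \<open>0\<close> for infinite-dimensional \<open>V\<close>, so finiteness of the dimension
  has to be stated separately.\<close>

definition finite_dim :: "'a ell2 set \<Rightarrow> bool"
  where "finite_dim V \<longleftrightarrow> (\<exists>B. finite B \<and> ell2.span B = V)"

text \<open>Well defined on closed subspaces by the projection theorem.\<close>

definition orth_proj :: "'a ell2 set \<Rightarrow> 'a ell2 \<Rightarrow> 'a ell2"
  where "orth_proj V x = (THE y. y \<in> V \<and> (\<forall>z\<in>V. cinner (x - y) z = 0))"

text \<open>Operators with domain \<open>V\<close> are total functions of which only the values on \<open>V\<close> matter.\<close>

definition linear_on_subspace :: "'a ell2 set \<Rightarrow> ('a ell2 \<Rightarrow> 'a ell2) \<Rightarrow> bool"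
  where "linear_on_subspace V T \<longleftrightarrow>
    (\<forall>x\<in>V. \<forall>y\<in>V. T (x + y) = T x + T y) \<and> (\<forall>c. \<forall>x\<in>V. T (c *\<^sub>C x) = c *\<^sub>C T x)"

definition op_norm_on :: "'a ell2 set \<Rightarrow> ('a ell2 \<Rightarrow> 'a ell2) \<Rightarrow> ereal"
  where "op_norm_on V T = (SUP x\<in>{x\<in>V. norm x \<le> 1}. ereal (norm (T x)))"

definition bounded_operator_on :: "'a ell2 set \<Rightarrow> ('a ell2 \<Rightarrow> 'a ell2) \<Rightarrow> bool"
  where "bounded_operator_on V T \<longleftrightarrow> linear_on_subspace V T \<and> op_norm_on V T < \<infinity>"

definition eigenvalues_on :: "'a ell2 set \<Rightarrow> ('a ell2 \<Rightarrow> 'a ell2) \<Rightarrow> complex set"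
  where "eigenvalues_on V T = {\<mu>. \<exists>x\<in>V. x \<noteq> 0 \<and> T x = \<mu> *\<^sub>C x}"


section \<open>Range functions and range operators\<close>

definition unit_cube :: "(real ^ 'd) set"
  where "unit_cube = {\<omega>. \<forall>i. 0 \<le> \<omega> $ i \<and> \<omega> $ i < 1}"

abbreviation cube_measure :: "(real ^ 'd) measure"
  where "cube_measure \<equiv> lebesgue_on unit_cube"

definition range_function :: "(real ^ 'd \<Rightarrow> (int ^ 'd) ell2 set) \<Rightarrow> bool"
  where "range_function J \<longleftrightarrow> (\<forall>\<omega>\<in>unit_cube. closed_subspace (J \<omega>))"

definition measurable_range_function :: "(real ^ 'd \<Rightarrow> (int ^ 'd) ell2 set) \<Rightarrow> bool"
  where "measurable_range_function J \<longleftrightarrow> range_function J \<and>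
    (\<forall>u v. (\<lambda>\<omega>. cinner (orth_proj (J \<omega>) u) v) \<in> borel_measurable cube_measure)"

text \<open>A range operator is only specified almost everywhere. Its values on the exceptional null set
  are irrelevant for measurability, since Lebesgue measure is complete.\<close>

definition range_operator ::
    "(real ^ 'd \<Rightarrow> (int ^ 'd) ell2 set) \<Rightarrow> (real ^ 'd \<Rightarrow> (int ^ 'd) ell2 \<Rightarrow> (int ^ 'd) ell2) \<Rightarrow> bool"
  where "range_operator J R \<longleftrightarrow> (AE \<omega> in cube_measure. bounded_operator_on (J \<omega>) (R \<omega>))"

definition measurable_range_operator ::
    "(real ^ 'd \<Rightarrow> (int ^ 'd) ell2 set) \<Rightarrow> (real ^ 'd \<Rightarrow> (int ^ 'd) ell2 \<Rightarrow> (int ^ 'd) ell2) \<Rightarrow> bool"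
  where "measurable_range_operator J R \<longleftrightarrow> range_operator J R \<and>
    (\<forall>u v. (\<lambda>\<omega>. cinner (R \<omega> (orth_proj (J \<omega>) u)) v) \<in> borel_measurable cube_measure)"

text \<open>Finiteness of the essential supremum of the operator norms.\<close>

definition bounded_range_operator ::
    "(real ^ 'd \<Rightarrow> (int ^ 'd) ell2 set) \<Rightarrow> (real ^ 'd \<Rightarrow> (int ^ 'd) ell2 \<Rightarrow> (int ^ 'd) ell2) \<Rightarrow> bool"
  where "bounded_range_operator J R \<longleftrightarrow> range_operator J R \<and>
    (\<exists>C::real. AE \<omega> in cube_measure. op_norm_on (J \<omega>) (R \<omega>) \<le> ereal C)"

definition L_infinity :: "(real ^ 'd \<Rightarrow> complex) set"
  where "L_infinity = {f. f \<in> borel_measurable cube_measure \<and>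
    (\<exists>C::real. AE \<omega> in cube_measure. cmod (f \<omega>) \<le> C)}"

definition dim_set :: "(real ^ 'd \<Rightarrow> (int ^ 'd) ell2 set) \<Rightarrow> nat \<Rightarrow> (real ^ 'd) set"
  where "dim_set J n = {\<omega>\<in>unit_cube. finite_dim (J \<omega>) \<and> ell2.dim (J \<omega>) = n}"

definition dim_eig_set ::
    "(real ^ 'd \<Rightarrow> (int ^ 'd) ell2 set) \<Rightarrow> (real ^ 'd \<Rightarrow> (int ^ 'd) ell2 \<Rightarrow> (int ^ 'd) ell2) \<Rightarrow>
      nat \<Rightarrow> nat \<Rightarrow> (real ^ 'd) set"
  where "dim_eig_set J R n i =
    {\<omega>\<in>dim_set J n. finite (eigenvalues_on (J \<omega>) (R \<omega>)) \<and> card (eigenvalues_on (J \<omega>) (R \<omega>)) = i}"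

end

theory Submission
  imports Defs
begin

text \<open>
  Two ideas carry the proof.

  The first is that the spectrum \<open>\<Sigma>(\<omega>)\<close> depends measurably on \<open>\<omega>\<close>, in the sense that the set of
  \<open>\<omega>\<close> for which \<open>\<Sigma>(\<omega>)\<close> meets a given open set is measurable. On a finite-dimensional space an operator fails to be
  injective as soon as it fails to be bounded below, so \<open>\<Sigma>(\<omega>)\<close> meets a compact set \<open>B\<close> if and only
  if \<open>\<parallel>(R(\<omega>) - z) x\<parallel> < \<epsilon> \<parallel>x\<parallel>\<close> has, for every \<open>\<epsilon> > 0\<close>, a solution \<open>z \<in> B\<close>, \<open>x \<in> J(\<omega>)\<close>. By continuity
  it is enough to test \<open>z\<close> in a countable dense subset of \<open>B\<close> and \<open>x\<close> among the projections to
  \<open>J(\<omega>)\<close> of the vectors of one countable dense subset of the whole space (lemma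
  \<open>eigenvalue_in_compact_iff\<close>). This leaves countably many conditions, each comparing norms of weakly
  measurable vector functions. Open sets are countable unions of compact boxes.

  The second is a measurable enumeration of finite sets that depend measurably on a parameter.
  Fix a countable basis of the plane. A finite nonempty set \<open>S\<close> meets some basic set in exactly one
  point; picking this point, for the first such basic set, is a measurable function of the
  parameter (lemma \<open>pick_measurable\<close>). Removing the point preserves measurability
  (lemma \<open>hit_measurable_remove\<close>), so the choice can be iterated. Once the set is exhausted, the
  enumeration continues with prescribed distinct values outside the disc which contains all
  eigenvalues; hence the functions stay bounded and pairwise distinct everywhere.
\<close>

section \<open>Complex inner product, orthonormal families and projections\<close>

lemma cinner_add_left: "cinner (x + y) z = cinner x z + cinner y z"
  unfolding cinner_def by (simp add: distrib_right infsum_add ell2_product_summable)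

lemma cinner_scaleC_left: "cinner (c *\<^sub>C x) y = c * cinner x y"
  unfolding cinner_def by (simp add: mult.assoc infsum_cmult_right')

lemma cinner_commute: "cinner y x = cnj (cinner x y)"
  unfolding cinner_def infsum_cnj[symmetric] by (simp add: mult.commute)

lemma cinner_zero_left [simp]: "cinner 0 x = 0"
  by (simp add: cinner_def)

lemma cinner_zero_right [simp]: "cinner x 0 = 0"
  by (simp add: cinner_def)

lemma cinner_diff_left: "cinner (x - y) z = cinner x z - cinner y z"
  using cinner_add_left[of "x - y" y z] by simp

lemma cinner_add_right: "cinner x (y + z) = cinner x y + cinner x z"
  by (subst (1 2 3) cinner_commute) (simp add: cinner_add_left)

lemma cinner_scaleC_right: "cinner x (c *\<^sub>C y) = cnj c * cinner x y"
  by (subst (1 2) cinner_commute) (simp add: cinner_scaleC_left)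

lemma cinner_sum_left: "cinner (sum f A) y = (\<Sum>a\<in>A. cinner (f a) y)"
  by (induction A rule: infinite_finite_induct) (auto simp: cinner_add_left)

lemma cinner_norm: "cinner x x = complex_of_real ((norm x)\<^sup>2)"
  by (simp add: cinner_self norm_ell2_def infsum_nonneg)

lemma cinner_self_eq_0 [simp]: "cinner x x = 0 \<longleftrightarrow> x = 0"
  by (simp add: cinner_norm)

lemma norm_scaleC: "norm (c *\<^sub>C x) = cmod c * norm x"
proof -
  have "cinner (c *\<^sub>C x) (c *\<^sub>C x) = (c * cnj c) * cinner x x"
    by (simp add: cinner_scaleC_left cinner_scaleC_right)
  also have "\<dots> = complex_of_real ((cmod c * norm x)\<^sup>2)"
    by (simp only: cinner_norm complex_norm_square[symmetric] of_real_mult power_mult_distrib)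
  finally have "complex_of_real ((norm (c *\<^sub>C x))\<^sup>2) = complex_of_real ((cmod c * norm x)\<^sup>2)"
    by (simp only: cinner_norm)
  then have "(norm (c *\<^sub>C x))\<^sup>2 = (cmod c * norm x)\<^sup>2"
    by (simp only: of_real_eq_iff)
  then show ?thesis
    by (rule power2_eq_imp_eq) simp_all
qed

text \<open>Cauchy--Schwarz for the real inner product, which is the real part of \<^const>\<open>cinner\<close>, gives the
  complex version after the first argument is rotated until the inner product is nonnegative.\<close>

lemma cmod_cinner_le: "cmod (cinner x y) \<le> norm x * norm y"
proof (cases "cinner x y = 0")
  case False
  define c where "c = cnj (cinner x y) / cmod (cinner x y)"
  have c: "cmod c = 1" using False by (simp add: c_def norm_divide)
  have "c * cinner x y = complex_of_real (cmod (cinner x y))"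
    using False by (simp add: c_def field_simps flip: complex_norm_square power2_eq_square)
  then have "cmod (cinner x y) = inner (c *\<^sub>C x) y"
    by (simp add: inner_ell2_def cinner_scaleC_left)
  also have "\<dots> \<le> norm (c *\<^sub>C x) * norm y" by (rule norm_cauchy_schwarz)
  finally show ?thesis by (simp add: norm_scaleC c)
qed simp

lemma tendsto_cinner_left:
  assumes "(f \<longlongrightarrow> x) F"
  shows "((\<lambda>t. cinner (f t) y) \<longlongrightarrow> cinner x y) F"
proof -
  have "((\<lambda>t. cinner (f t - x) y) \<longlongrightarrow> 0) F"
  proof (rule Lim_null_comparison)
    show "\<forall>\<^sub>F t in F. cmod (cinner (f t - x) y) \<le> norm (f t - x) * norm y"
      by (simp add: cmod_cinner_le)
    show "((\<lambda>t. norm (f t - x) * norm y) \<longlongrightarrow> 0) F"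
      using assms by (auto intro!: tendsto_mult_left_zero tendsto_norm_zero simp: LIM_zero_iff)
  qed
  then show ?thesis by (simp add: cinner_diff_left LIM_zero_iff)
qed

lemma tendsto_scaleC:
  assumes "(c \<longlongrightarrow> a) F"
  shows "((\<lambda>t. c t *\<^sub>C x) \<longlongrightarrow> a *\<^sub>C x) F"
proof -
  have "((\<lambda>t. (c t - a) *\<^sub>C x) \<longlongrightarrow> 0) F"
  proof (rule Lim_null_comparison)
    show "\<forall>\<^sub>F t in F. norm ((c t - a) *\<^sub>C x) \<le> cmod (c t - a) * norm x"
      by (simp add: norm_scaleC)
    show "((\<lambda>t. cmod (c t - a) * norm x) \<longlongrightarrow> 0) F"
      using assms by (auto intro!: tendsto_mult_left_zero tendsto_norm_zero simp: LIM_zero_iff)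
  qed
  then show ?thesis by (simp add: ell2.scale_left_diff_distrib LIM_zero_iff)
qed

definition orthonormal :: "'a ell2 set \<Rightarrow> bool"
  where "orthonormal E \<longleftrightarrow> finite E \<and> (\<forall>e\<in>E. \<forall>f\<in>E. cinner e f = (if e = f then 1 else 0))"

lemma orthonormal_finite: "orthonormal E \<Longrightarrow> finite E"
  by (simp add: orthonormal_def)

lemma orthonormal_norm:
  assumes "orthonormal E" "e \<in> E"
  shows "norm e = 1"
proof -
  have "complex_of_real ((norm e)\<^sup>2) = 1"
    unfolding cinner_norm[symmetric] using assms by (simp add: orthonormal_def)
  then have "(norm e)\<^sup>2 = 1" using of_real_eq_1_iff by blast
  then show ?thesis using norm_ge_zero[of e] by (auto simp: power2_eq_1_iff)
qed

definition fourier_sum :: "'a ell2 set \<Rightarrow> 'a ell2 \<Rightarrow> 'a ell2"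
  where "fourier_sum E x = (\<Sum>e\<in>E. cinner x e *\<^sub>C e)"

lemma fourier_sum_in_span: "fourier_sum E x \<in> ell2.span E"
  unfolding fourier_sum_def by (intro ell2.span_sum ell2.span_scale ell2.span_base)

lemma fourier_sum_orthogonal:
  assumes "orthonormal E" "z \<in> ell2.span E"
  shows "cinner (x - fourier_sum E x) z = 0"
  using assms(2)
proof (induction rule: ell2.span_induct_alt)
  case (step c e y)
  have "cinner (fourier_sum E x) e = (\<Sum>f\<in>E. if f = e then cinner x f else 0)"
    unfolding fourier_sum_def cinner_sum_left cinner_scaleC_left
    using assms(1) step(1) by (intro sum.cong) (auto simp: orthonormal_def)
  then show ?case
    using step orthonormal_finite[OF assms(1)]
    by (simp add: cinner_add_right cinner_scaleC_right cinner_diff_left)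
qed simp

lemma orthogonal_decomposition_unique:
  assumes "ell2.subspace V" "y \<in> V" "y' \<in> V"
    and "\<And>z. z \<in> V \<Longrightarrow> cinner (x - y) z = 0" "\<And>z. z \<in> V \<Longrightarrow> cinner (x - y') z = 0"
  shows "y = y'"
proof -
  have "y - y' \<in> V" using assms(1-3) by (rule ell2.subspace_diff)
  then have "cinner (x - y') (y - y') - cinner (x - y) (y - y') = 0" using assms(4,5) by simp
  then have "cinner (y - y') (y - y') = 0" by (simp add: cinner_diff_left)
  then show ?thesis by simp
qed

text \<open>The definite description in \<^const>\<open>orth_proj\<close> is thereby resolved for finite-dimensional subspaces,
  without the projection theorem and hence without completeness of the ambient space.\<close>

lemma orth_proj_eq_fourier_sum:
  assumes "orthonormal E"
  shows "orth_proj (ell2.span E) x = fourier_sum E x"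
  unfolding orth_proj_def
proof (rule the_equality)
  show *: "fourier_sum E x \<in> ell2.span E \<and> (\<forall>z\<in>ell2.span E. cinner (x - fourier_sum E x) z = 0)"
    using fourier_sum_in_span fourier_sum_orthogonal[OF assms] by blast
  show "y = fourier_sum E x"
    if "y \<in> ell2.span E \<and> (\<forall>z\<in>ell2.span E. cinner (x - y) z = 0)" for y
    by (rule orthogonal_decomposition_unique[OF ell2.subspace_span[of E]]) (use * that in auto)
qed

lemma fourier_sum_fixes:
  assumes "orthonormal E" "x \<in> ell2.span E"
  shows "fourier_sum E x = x"
  by (rule orthogonal_decomposition_unique[OF ell2.subspace_span[of E], of _ _ x])
    (use assms fourier_sum_in_span[of E x] fourier_sum_orthogonal[OF assms(1)] in auto)

text \<open>Gram--Schmidt: the new basis vector is the normalised difference between \<open>b\<close> and its projection to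
  the span found so far, unless that difference vanishes.\<close>

lemma orthonormal_basis_exists:
  assumes "finite B"
  shows "\<exists>E. orthonormal E \<and> ell2.span E = ell2.span B"
  using assms
proof induction
  case empty
  then show ?case by (auto simp: orthonormal_def intro!: exI[of _ "{}"])
next
  case (insert b B)
  then obtain E where E: "orthonormal E" "ell2.span E = ell2.span B" by blast
  define c where "c = b - fourier_sum E b"
  have span_c: "ell2.span (insert c E) = ell2.span (insert b B)"
  proof -
    have "ell2.span (insert c E) = ell2.span (insert b E)"
    proof (rule ell2.span_eq[THEN iffD2], intro conjI insert_subsetI)
      have *: "fourier_sum E b \<in> ell2.span (insert x E)" for x
        using fourier_sum_in_span ell2.span_mono[of E "insert x E"] by blast
      show "c \<in> ell2.span (insert b E)"
        unfolding c_def by (rule ell2.span_diff[OF ell2.span_base *]) simp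
      have "c + fourier_sum E b \<in> ell2.span (insert c E)"
        by (rule ell2.span_add[OF ell2.span_base *]) simp
      then show "b \<in> ell2.span (insert c E)" by (simp add: c_def)
    qed (auto intro: ell2.span_base)
    then show ?thesis using E(2) by (simp add: ell2.span_insert)
  qed
  show ?case
  proof (cases "c = 0")
    case True
    then show ?thesis using span_c E(1) by auto
  next
    case False
    define a where "a = complex_of_real (inverse (norm c))"
    have a: "a \<noteq> 0" "a * cnj a * cinner c c = 1"
      using False by (auto simp: a_def cinner_norm field_simps power2_eq_square)
    have ce: "cinner c e = 0" if "e \<in> E" for e
      unfolding c_def using fourier_sum_orthogonal[OF E(1)] ell2.span_base[OF that] by blast
    then have ec: "cinner e c = 0" if "e \<in> E" for e
      using that cinner_commute[of e c] by simp
    have "orthonormal (insert (a *\<^sub>C c) E)"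
    proof -
      have "a *\<^sub>C c \<notin> E"
        using ce[of "a *\<^sub>C c"] a(1) False by (auto simp: cinner_scaleC_right)
      then show ?thesis
        using E(1) a ce ec
        by (auto simp: orthonormal_def cinner_scaleC_left cinner_scaleC_right mult_ac)
    qed
    moreover have "ell2.span (insert (a *\<^sub>C c) E) = ell2.span (insert c E)"
    proof (rule ell2.span_eq[THEN iffD2], intro conjI insert_subsetI)
      show "a *\<^sub>C c \<in> ell2.span (insert c E)" by (intro ell2.span_scale ell2.span_base) simp
      have "inverse a *\<^sub>C a *\<^sub>C c \<in> ell2.span (insert (a *\<^sub>C c) E)"
        by (intro ell2.span_scale ell2.span_base) simp
      then show "c \<in> ell2.span (insert (a *\<^sub>C c) E)" using a by simp
    qed (auto intro: ell2.span_base)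
    ultimately show ?thesis using span_c by blast
  qed
qed

lemma finite_dim_orthonormal_basis:
  assumes "finite_dim V"
  obtains E where "orthonormal E" "ell2.span E = V"
  using assms orthonormal_basis_exists unfolding finite_dim_def by metis

lemma finite_dim_subspace: "finite_dim V \<Longrightarrow> ell2.subspace V"
  by (auto simp: finite_dim_def)

lemma orth_proj_in: "finite_dim V \<Longrightarrow> orth_proj V x \<in> V"
  by (metis finite_dim_orthonormal_basis orth_proj_eq_fourier_sum fourier_sum_in_span)

lemma orth_proj_fixes: "finite_dim V \<Longrightarrow> x \<in> V \<Longrightarrow> orth_proj V x = x"
  by (metis finite_dim_orthonormal_basis orth_proj_eq_fourier_sum fourier_sum_fixes)

lemma orth_proj_add:
  assumes "finite_dim V"
  shows "orth_proj V (x + y) = orth_proj V x + orth_proj V y"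
proof -
  obtain E where E: "orthonormal E" "ell2.span E = V" by (rule finite_dim_orthonormal_basis[OF assms])
  show ?thesis
    unfolding E(2)[symmetric] orth_proj_eq_fourier_sum[OF E(1)]
    by (simp add: fourier_sum_def cinner_add_left ell2.scale_left_distrib sum.distrib)
qed

lemma orth_proj_scaleC:
  assumes "finite_dim V"
  shows "orth_proj V (c *\<^sub>C x) = c *\<^sub>C orth_proj V x"
proof -
  obtain E where E: "orthonormal E" "ell2.span E = V" by (rule finite_dim_orthonormal_basis[OF assms])
  show ?thesis
    unfolding E(2)[symmetric] orth_proj_eq_fourier_sum[OF E(1)]
    by (simp add: fourier_sum_def cinner_scaleC_left ell2.scale_sum_right)
qed

section \<open>Operators on finite-dimensional subspaces\<close>

lemma linear_on_subspace_sum: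
  assumes V: "ell2.subspace V" and T: "linear_on_subspace V T"
    and "finite A" and "\<And>a. a \<in> A \<Longrightarrow> f a \<in> V"
  shows "T (sum f A) = (\<Sum>a\<in>A. T (f a))"
proof -
  have "T (0 *\<^sub>C 0) = 0 *\<^sub>C T 0"
    using T ell2.subspace_0[OF V] unfolding linear_on_subspace_def by blast
  then have "T 0 = 0" by simp
  with assms(3,4) show ?thesis
  proof (induction A)
    case (insert a A)
    have "sum f A \<in> V" using insert by (intro ell2.subspace_sum[OF V]) auto
    then show ?case using insert T unfolding linear_on_subspace_def by simp
  qed simp
qed

lemma linear_on_subspace_fourier:
  assumes E: "orthonormal E" and T: "linear_on_subspace (ell2.span E) T"
  shows "T (fourier_sum E x) = (\<Sum>e\<in>E. cinner x e *\<^sub>C T e)"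
proof -
  have "T (fourier_sum E x) = (\<Sum>e\<in>E. T (cinner x e *\<^sub>C e))"
    unfolding fourier_sum_def
    by (rule linear_on_subspace_sum[OF ell2.subspace_span T orthonormal_finite[OF E]])
      (auto intro: ell2.span_scale ell2.span_base)
  also have "\<dots> = (\<Sum>e\<in>E. cinner x e *\<^sub>C T e)"
    using T by (intro sum.cong) (auto simp: linear_on_subspace_def ell2.span_base)
  finally show ?thesis .
qed

lemma finite_dim_linear_bounded:
  assumes "finite_dim V" and T: "linear_on_subspace V T"
  obtains K where "K > 0" "\<And>x. x \<in> V \<Longrightarrow> norm (T x) \<le> K * norm x"
proof -
  obtain E where E: "orthonormal E" "ell2.span E = V"
    by (rule finite_dim_orthonormal_basis[OF assms(1)])
  define K where "K = 1 + (\<Sum>e\<in>E. norm (T e))"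
  show thesis
  proof
    show "K > 0" unfolding K_def by (simp add: add_pos_nonneg sum_nonneg)
    fix x assume "x \<in> V"
    then have "T x = (\<Sum>e\<in>E. cinner x e *\<^sub>C T e)"
      using linear_on_subspace_fourier[OF E(1)] fourier_sum_fixes[OF E(1)] T E(2) by metis
    also have "norm \<dots> \<le> (\<Sum>e\<in>E. norm x * norm (T e))"
    proof (rule sum_norm_le)
      fix e assume "e \<in> E"
      then have "cmod (cinner x e) \<le> norm x"
        using cmod_cinner_le[of x e] orthonormal_norm[OF E(1)] by simp
      then show "norm (cinner x e *\<^sub>C T e) \<le> norm x * norm (T e)"
        by (simp add: norm_scaleC mult_right_mono)
    qed
    also have "\<dots> \<le> K * norm x"
      by (simp add: K_def algebra_simps flip: sum_distrib_left)
    finally show "norm (T x) \<le> K * norm x" .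
  qed
qed

lemma continuous_on_operator_orth_proj:
  assumes "finite_dim V" and T: "linear_on_subspace V T"
  shows "continuous_on UNIV (\<lambda>u. T (orth_proj V u))"
proof -
  obtain E where E: "orthonormal E" "ell2.span E = V"
    by (rule finite_dim_orthonormal_basis[OF assms(1)])
  have eq: "T (orth_proj V u) = (\<Sum>e\<in>E. cinner u e *\<^sub>C T e)" for u
    using linear_on_subspace_fourier[OF E(1)] orth_proj_eq_fourier_sum[OF E(1)] T E(2) by metis
  show ?thesis
    unfolding eq continuous_on_def
    by (intro ballI tendsto_sum tendsto_scaleC tendsto_cinner_left tendsto_ident_at)
qed

text \<open>The left inverse of \<open>T\<close> is a linear map on the finite-dimensional image of \<open>V\<close>, and therefore
  bounded; its bound is the constant \<open>K\<close>.\<close>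

lemma finite_dim_injective_bounded_below:
  assumes V: "finite_dim V" and T: "linear_on_subspace V T"
    and inj: "\<And>x. x \<in> V \<Longrightarrow> T x = 0 \<Longrightarrow> x = 0"
  obtains K where "K > 0" "\<And>x. x \<in> V \<Longrightarrow> norm x \<le> K * norm (T x)"
proof -
  interpret vector_space_pair "scaleC :: complex \<Rightarrow> 'a ell2 \<Rightarrow> 'a ell2"
      "scaleC :: complex \<Rightarrow> 'a ell2 \<Rightarrow> 'a ell2"
    by unfold_locales
  \<comment> \<open>Composing with the projection makes the operator linear on the whole space.\<close>
  define f where "f = (\<lambda>x. T (orth_proj V x))"
  obtain B where B: "finite B" "ell2.span B = V" using V by (auto simp: finite_dim_def)
  have f_V: "f x = T x" if "x \<in> V" for x by (simp add: f_def orth_proj_fixes[OF V that])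
  have lin: "Vector_Spaces.linear scaleC scaleC f"
    unfolding Vector_Spaces.linear_iff f_def
    using T orth_proj_in[OF V]
    by (auto simp: orth_proj_add[OF V] orth_proj_scaleC[OF V] linear_on_subspace_def
        intro: ell2.vector_space_axioms)
  have "inj_on f V"
  proof (rule inj_onI)
    fix x y assume "x \<in> V" "y \<in> V" "f x = f y"
    moreover have "f (x - y) = f x - f y" by (rule linear_diff[OF lin])
    ultimately show "x = y"
      using inj[of "x - y"] ell2.subspace_diff[OF finite_dim_subspace[OF V]] by (simp add: f_V)
  qed
  with linear_inj_on_left_inverse[OF lin, of B] B
  obtain g where g: "Vector_Spaces.linear scaleC scaleC g" "\<And>x. x \<in> V \<Longrightarrow> g (f x) = x" by auto
  have "finite_dim (f ` V)"
    unfolding finite_dim_def B(2)[symmetric]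
    by (intro exI[of _ "f ` B"]) (simp add: linear_span_image[OF lin] B(1))
  moreover have "linear_on_subspace (f ` V) g"
    unfolding linear_on_subspace_def by (simp add: linear_add[OF g(1)] linear_scale[OF g(1)])
  ultimately obtain K where K: "K > 0" "\<And>y. y \<in> f ` V \<Longrightarrow> norm (g y) \<le> K * norm y"
    by (rule finite_dim_linear_bounded) blast
  show thesis
  proof
    fix x assume "x \<in> V"
    then show "norm x \<le> K * norm (T x)" using K(2)[of "f x"] g(2) f_V by auto
  qed fact
qed

section \<open>Measurable enumeration of finite sets\<close>

text \<open>For closed-valued maps this is weak measurability of multifunctions. Testing against open sets
  makes it stable under intersection of the values with a fixed open set.\<close>

definition hit_measurable :: "'m measure \<Rightarrow> ('m \<Rightarrow> 'b::topological_space set) \<Rightarrow> bool"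
  where "hit_measurable M S \<longleftrightarrow> (\<forall>U. open U \<longrightarrow> Measurable.pred M (\<lambda>\<omega>. S \<omega> \<inter> U \<noteq> {}))"

definition basis_seq :: "(nat \<Rightarrow> 'b::topological_space set) \<Rightarrow> bool"
  where "basis_seq K \<longleftrightarrow> (\<forall>n. open (K n)) \<and> (\<forall>U z. open U \<longrightarrow> z \<in> U \<longrightarrow> (\<exists>n. z \<in> K n \<and> K n \<subseteq> U))"

lemma basis_seq_exists: "\<exists>K :: nat \<Rightarrow> 'b::second_countable_topology set. basis_seq K"
proof -
  obtain B :: "'b set set" where B: "countable B" "topological_basis B"
    using ex_countable_basis by blast
  obtain U0 where "U0 \<in> B"
    using topological_basisE[OF B(2) open_UNIV UNIV_I] by blast
  then have ne: "B \<noteq> {}" by blast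
  show ?thesis
  proof (intro exI[of _ "from_nat_into B"], unfold basis_seq_def, intro conjI allI impI)
    show "open (from_nat_into B n)" for n
      using topological_basis_open[OF B(2)] from_nat_into[OF ne] by blast
    fix U :: "'b set" and z assume "open U" "z \<in> U"
    then obtain V where "V \<in> B" "z \<in> V" "V \<subseteq> U"
      using topological_basisE[OF B(2)] by metis
    then show "\<exists>n. z \<in> from_nat_into B n \<and> from_nat_into B n \<subseteq> U"
      using from_nat_into_surj[OF B(1)] by metis
  qed
qed

lemma basis_seq_separates:
  fixes K :: "nat \<Rightarrow> 'b::t2_space set"
  assumes "basis_seq K" "y \<noteq> z"
  obtains a b where "y \<in> K a" "z \<in> K b" "K a \<inter> K b = {}"
proof -
  obtain U V where "open U" "open V" "y \<in> U" "z \<in> V" "U \<inter> V = {}"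
    using hausdorff[OF assms(2)] by blast
  moreover from this obtain a b where "y \<in> K a" "K a \<subseteq> U" "z \<in> K b" "K b \<subseteq> V"
    using assms(1) unfolding basis_seq_def by metis
  ultimately show thesis using that by blast
qed

text \<open>The basic sets which isolate a point of \<open>S\<close> serve as addresses of points of \<open>S\<close>: only countably many
  addresses exist, so the choice of the first one is measurable.\<close>

definition isolates :: "(nat \<Rightarrow> 'b set) \<Rightarrow> 'b set \<Rightarrow> nat \<Rightarrow> bool"
  where "isolates K S n \<longleftrightarrow> (\<exists>z. S \<inter> K n = {z})"

definition pick :: "(nat \<Rightarrow> 'b set) \<Rightarrow> 'b \<Rightarrow> 'b set \<Rightarrow> 'b"
  where "pick K c S =
    (if \<exists>n. isolates K S n then THE z. z \<in> S \<inter> K (LEAST n. isolates K S n) else c)"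

lemma pick_isolated:
  assumes "isolates K S n" "\<And>m. m < n \<Longrightarrow> \<not> isolates K S m"
  shows "S \<inter> K n = {pick K c S}"
proof -
  have "(LEAST n. isolates K S n) = n"
    using assms by (intro Least_equality) (auto simp: not_less[symmetric])
  moreover obtain z where "S \<inter> K n = {z}" using assms(1) by (auto simp: isolates_def)
  ultimately show ?thesis using assms(1) by (auto simp: pick_def)
qed

lemma first_isolating:
  assumes "isolates K S m"
  obtains n where "isolates K S n" "\<And>m. m < n \<Longrightarrow> \<not> isolates K S m"
  using assms LeastI[of "isolates K S"] not_less_Least[of _ "isolates K S"] by blast

lemma pick_cases: "pick K c S \<in> S \<or> pick K c S = c"
proof (cases "\<exists>n. isolates K S n")
  case True
  then obtain n where "S \<inter> K n = {pick K c S}" using first_isolating pick_isolated by metis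
  then show ?thesis by blast
qed (simp add: pick_def)

text \<open>In a finite set every point is isolated, so an address exists.\<close>

lemma pick_in:
  fixes K :: "nat \<Rightarrow> 'b::t1_space set"
  assumes "basis_seq K" "finite S" "S \<noteq> {}"
  shows "pick K c S \<in> S"
proof -
  obtain z where z: "z \<in> S" using assms(3) by blast
  have "open (- (S - {z}))" using assms(2) by (intro open_Compl finite_imp_closed) simp
  then obtain n where "z \<in> K n" "K n \<subseteq> - (S - {z})"
    using assms(1) unfolding basis_seq_def by (metis ComplI Diff_iff singletonI)
  then have "S \<inter> K n = {z}" using z by blast
  then have "isolates K S n" by (auto simp: isolates_def)
  then obtain n where "S \<inter> K n = {pick K c S}" using first_isolating pick_isolated by metis
  then show ?thesis by blast
qed

text \<open>A set meets \<open>K n\<close> in more than one point if and only if it meets two disjoint basic sets inside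
  \<open>K n\<close>; this turns isolation into countably many hitting conditions.\<close>

lemma pred_isolates:
  fixes S :: "'m \<Rightarrow> 'b::t2_space set"
  assumes K: "basis_seq K" and S: "hit_measurable M S"
  shows "Measurable.pred M (\<lambda>\<omega>. isolates K (S \<omega>) n)"
proof -
  have eq: "isolates K T n \<longleftrightarrow> T \<inter> K n \<noteq> {} \<and>
      (\<forall>a b. K a \<inter> K b = {} \<longrightarrow> \<not> (T \<inter> (K n \<inter> K a) \<noteq> {} \<and> T \<inter> (K n \<inter> K b) \<noteq> {}))" for T
  proof
    assume "isolates K T n"
    then obtain z where z: "T \<inter> K n = {z}" unfolding isolates_def by blast
    have "T \<inter> (K n \<inter> K a) = {z} \<inter> K a" for a using z by blast
    then show "T \<inter> K n \<noteq> {} \<and>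
      (\<forall>a b. K a \<inter> K b = {} \<longrightarrow> \<not> (T \<inter> (K n \<inter> K a) \<noteq> {} \<and> T \<inter> (K n \<inter> K b) \<noteq> {}))"
      using z by auto
  next
    assume *: "T \<inter> K n \<noteq> {} \<and>
      (\<forall>a b. K a \<inter> K b = {} \<longrightarrow> \<not> (T \<inter> (K n \<inter> K a) \<noteq> {} \<and> T \<inter> (K n \<inter> K b) \<noteq> {}))"
    then obtain z where z: "z \<in> T \<inter> K n" by blast
    have "y = z" if "y \<in> T \<inter> K n" for y
    proof (rule ccontr)
      assume "y \<noteq> z"
      then obtain a b where "y \<in> K a" "z \<in> K b" "K a \<inter> K b = {}"
        by (rule basis_seq_separates[OF K])
      moreover have "T \<inter> (K n \<inter> K a) \<noteq> {}" "T \<inter> (K n \<inter> K b) \<noteq> {}"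
        using calculation(1,2) z that by blast+
      ultimately show False using * by blast
    qed
    then have "T \<inter> K n = {z}" using z by blast
    then show "isolates K T n" by (simp add: isolates_def)
  qed
  have [measurable]: "Measurable.pred M (\<lambda>\<omega>. S \<omega> \<inter> K n \<noteq> {})"
    "Measurable.pred M (\<lambda>\<omega>. S \<omega> \<inter> (K n \<inter> K a) \<noteq> {})" for n a
    using S K unfolding hit_measurable_def basis_seq_def by (simp_all add: open_Int)
  show ?thesis unfolding eq by measurable
qed

text \<open>If \<open>K n\<close> is the first isolating set, then the chosen point lies in \<open>U\<close> if and only if the set
  meets \<open>K n \<inter> U\<close>.\<close>

lemma pick_measurable:
  fixes S :: "'m \<Rightarrow> 'b::t2_space set"
  assumes K: "basis_seq K" and S: "hit_measurable M S"
  shows "(\<lambda>\<omega>. pick K c (S \<omega>)) \<in> borel_measurable M"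
proof (rule borel_measurableI)
  fix U :: "'b set" assume U: "open U"
  have eq: "pick K c T \<in> U \<longleftrightarrow>
      (\<exists>n. isolates K T n \<and> (\<forall>m<n. \<not> isolates K T m) \<and> T \<inter> (K n \<inter> U) \<noteq> {}) \<or>
      (\<forall>n. \<not> isolates K T n) \<and> c \<in> U" for T
  proof (cases "\<exists>n. isolates K T n")
    case True
    then obtain n where n: "isolates K T n" "\<And>m. m < n \<Longrightarrow> \<not> isolates K T m"
      using first_isolating by metis
    have unique: "n' = n" if "isolates K T n'" "\<forall>m<n'. \<not> isolates K T m" for n'
      using n that by (metis linorder_neqE_nat)
    have "T \<inter> (K n \<inter> U) = {pick K c T} \<inter> U"
      using pick_isolated[OF n, of c] by blast
    then have "pick K c T \<in> U \<longleftrightarrow> T \<inter> (K n \<inter> U) \<noteq> {}" by simp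
    also have "\<dots> \<longleftrightarrow> (\<exists>n'. isolates K T n' \<and> (\<forall>m<n'. \<not> isolates K T m) \<and> T \<inter> (K n' \<inter> U) \<noteq> {})"
      using n unique by metis
    finally show ?thesis using n(1) by blast
  qed (simp add: pick_def)
  have [measurable]: "Measurable.pred M (\<lambda>\<omega>. S \<omega> \<inter> (K n \<inter> U) \<noteq> {})" for n
    using S K U unfolding hit_measurable_def basis_seq_def by (simp add: open_Int)
  note [measurable] = pred_isolates[OF K S]
  have "Measurable.pred M (\<lambda>\<omega>. pick K c (S \<omega>) \<in> U)" unfolding eq by measurable
  then show "(\<lambda>\<omega>. pick K c (S \<omega>)) -` U \<inter> space M \<in> sets M"
    by (simp add: pred_def vimage_def Int_def conj_commute)
qed

text \<open>A point of \<open>S \<omega> \<inter> U\<close> other than \<open>f \<omega>\<close> is detected by a basic set that contains it but does not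
  contain \<open>f \<omega>\<close>.\<close>

lemma hit_measurable_remove:
  fixes S :: "'m \<Rightarrow> 'b::t2_space set" and K :: "nat \<Rightarrow> 'b set"
  assumes K: "basis_seq K" and S: "hit_measurable M S" and [measurable]: "f \<in> borel_measurable M"
  shows "hit_measurable M (\<lambda>\<omega>. S \<omega> - {f \<omega>})"
  unfolding hit_measurable_def
proof (intro allI impI)
  fix U :: "'b set" assume U: "open U"
  have eq: "(T - {y}) \<inter> U \<noteq> {} \<longleftrightarrow> (\<exists>n. T \<inter> (U \<inter> K n) \<noteq> {} \<and> y \<notin> K n)" for T y
  proof
    assume "(T - {y}) \<inter> U \<noteq> {}"
    then obtain z where z: "z \<in> T" "z \<in> U" "z \<noteq> y" by blast
    then obtain a b where "z \<in> K a" "y \<in> K b" "K a \<inter> K b = {}"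
      using basis_seq_separates[OF K] by metis
    then show "\<exists>n. T \<inter> (U \<inter> K n) \<noteq> {} \<and> y \<notin> K n" using z by blast
  qed blast
  have [measurable]: "K n \<in> sets borel" for n
    using K by (simp add: basis_seq_def)
  have [measurable]: "Measurable.pred M (\<lambda>\<omega>. S \<omega> \<inter> (U \<inter> K n) \<noteq> {})" for n
    using S K U unfolding hit_measurable_def basis_seq_def by (simp add: open_Int)
  show "Measurable.pred M (\<lambda>\<omega>. (S \<omega> - {f \<omega>}) \<inter> U \<noteq> {})"
    unfolding eq by measurable
qed

primrec remaining :: "(nat \<Rightarrow> 'b set) \<Rightarrow> (nat \<Rightarrow> 'b) \<Rightarrow> 'b set \<Rightarrow> nat \<Rightarrow> 'b set"
  where
    "remaining K c S 0 = S"
  | "remaining K c S (Suc j) = remaining K c S j - {pick K (c j) (remaining K c S j)}"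

definition nth_pick :: "(nat \<Rightarrow> 'b set) \<Rightarrow> (nat \<Rightarrow> 'b) \<Rightarrow> 'b set \<Rightarrow> nat \<Rightarrow> 'b"
  where "nth_pick K c S j = pick K (c j) (remaining K c S j)"

lemma remaining_eq: "remaining K c S j = S - nth_pick K c S ` {..<j}"
  by (induction j) (auto simp: nth_pick_def lessThan_Suc)

lemma nth_pick_cases: "nth_pick K c S j \<in> remaining K c S j \<or> nth_pick K c S j = c j"
  unfolding nth_pick_def by (rule pick_cases)

lemma nth_pick_in_or_default: "nth_pick K c S j \<in> S \<or> nth_pick K c S j = c j"
  using nth_pick_cases[of K c S j] by (auto simp: remaining_eq)

text \<open>A point that has been picked is removed, and the default values avoid \<open>S\<close> and each other.\<close>

lemma inj_nth_pick:
  assumes "inj c" "range c \<inter> S = {}"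
  shows "inj (nth_pick K c S)"
proof (rule linorder_injI)
  fix j k :: nat assume "j < k"
  show "nth_pick K c S j \<noteq> nth_pick K c S k"
  proof
    assume eq: "nth_pick K c S j = nth_pick K c S k"
    then have "nth_pick K c S k \<in> nth_pick K c S ` {..<k}"
      using \<open>j < k\<close> by (intro image_eqI[of _ _ j]) auto
    then have "nth_pick K c S k \<notin> remaining K c S k" by (simp add: remaining_eq)
    then have "nth_pick K c S k = c k" using nth_pick_cases by metis
    moreover from this eq have "nth_pick K c S j = c j"
      using nth_pick_in_or_default[of K c S j] assms(2) by auto
    ultimately show False using eq \<open>j < k\<close> injD[OF assms(1)] by fastforce
  qed
qed

text \<open>As long as fewer than \<open>card S\<close> points have been removed, a point of \<open>S\<close> is left to be picked.\<close>

lemma nth_pick_image: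
  fixes K :: "nat \<Rightarrow> 'b::t1_space set"
  assumes K: "basis_seq K" and c: "inj c" "range c \<inter> S = {}" and S: "finite S"
  shows "nth_pick K c S ` {..<card S} = S"
proof (rule card_subset_eq[OF S])
  show "card (nth_pick K c S ` {..<card S}) = card S"
    using card_image[OF inj_on_subset[OF inj_nth_pick[OF c] subset_UNIV]] by simp
  show "nth_pick K c S ` {..<card S} \<subseteq> S"
  proof clarify
    fix j assume "j < card S"
    moreover have "card (nth_pick K c S ` {..<j}) \<le> j"
      using card_image_le[of "{..<j}" "nth_pick K c S"] by simp
    ultimately have "\<not> S \<subseteq> nth_pick K c S ` {..<j}"
      using card_mono[of "nth_pick K c S ` {..<j}" S] by fastforce
    then have "remaining K c S j \<noteq> {}" "finite (remaining K c S j)"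
      using S by (auto simp: remaining_eq)
    then have "nth_pick K c S j \<in> remaining K c S j"
      unfolding nth_pick_def by (intro pick_in[OF K])
    then show "nth_pick K c S j \<in> S" by (simp add: remaining_eq)
  qed
qed

lemma nth_pick_measurable:
  fixes S :: "'m \<Rightarrow> 'b::t2_space set"
  assumes K: "basis_seq K" and S: "hit_measurable M S"
  shows "(\<lambda>\<omega>. nth_pick K c (S \<omega>) j) \<in> borel_measurable M"
proof -
  have "hit_measurable M (\<lambda>\<omega>. remaining K c (S \<omega>) j)"
    by (induction j) (auto intro: S hit_measurable_remove[OF K] pick_measurable[OF K])
  then show ?thesis unfolding nth_pick_def by (rule pick_measurable[OF K])
qed

section \<open>Separability\<close>

definition unit_vec :: "'a \<Rightarrow> 'a ell2"
  where "unit_vec k = Abs_ell2 (\<lambda>i. if i = k then 1 else 0)"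

lemma ell2_apply_unit_vec [simp]: "ell2_apply (unit_vec k) i = (if i = k then 1 else 0)"
proof -
  have "(\<lambda>i. (cmod (if i = k then 1 else 0))\<^sup>2) summable_on UNIV \<longleftrightarrow>
      (\<lambda>i. (cmod (if i = k then 1 else 0))\<^sup>2) summable_on {k}"
    by (rule summable_on_cong_neutral) auto
  then show ?thesis by (simp add: unit_vec_def Abs_ell2_inverse)
qed

lemma cinner_unit_vec: "cinner x (unit_vec k) = ell2_apply x k"
proof -
  have "cinner x (unit_vec k) = (\<Sum>\<^sub>\<infinity>i\<in>{k}. ell2_apply x i * cnj (ell2_apply (unit_vec k) i))"
    unfolding cinner_def by (rule infsum_cong_neutral) auto
  then show ?thesis by simp
qed

lemma norm_ell2_square: "(norm x)\<^sup>2 = (\<Sum>\<^sub>\<infinity>k. (cmod (ell2_apply x k))\<^sup>2)"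
  by (simp add: norm_ell2_def infsum_nonneg)

lemma ell2_apply_sum: "ell2_apply (sum f A) k = (\<Sum>a\<in>A. ell2_apply (f a) k)"
  by (induction A rule: infinite_finite_induct) auto

lemma finite_truncation_approximates:
  fixes x :: "'a ell2"
  assumes "e > 0"
  obtains F where "finite F" "norm (x - (\<Sum>k\<in>F. ell2_apply x k *\<^sub>C unit_vec k)) < e"
proof -
  define f where "f = (\<lambda>k. (cmod (ell2_apply x k))\<^sup>2)"
  have f: "f summable_on UNIV" unfolding f_def by (rule ell2_apply_summable)
  obtain F where F: "finite F" "dist (sum f F) (infsum f UNIV) \<le> e\<^sup>2 / 2"
    using has_sum_finite_approximation[OF has_sum_infsum[OF f], of "e\<^sup>2 / 2"] assms by auto
  define y where "y = x - (\<Sum>k\<in>F. ell2_apply x k *\<^sub>C unit_vec k)"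
  have y: "ell2_apply y i = (if i \<in> F then 0 else ell2_apply x i)" for i
  proof -
    have "(\<Sum>k\<in>F. ell2_apply x k * (if i = k then 1 else 0)) = (\<Sum>k\<in>F. if i = k then ell2_apply x k else 0)"
      by (rule sum.cong) auto
    also have "\<dots> = (if i \<in> F then ell2_apply x i else 0)"
      using F(1) by simp
    finally show ?thesis by (simp add: y_def ell2_apply_sum)
  qed
  have "(norm y)\<^sup>2 = infsum f (UNIV - F)"
    unfolding norm_ell2_square by (rule infsum_cong_neutral) (auto simp: y f_def)
  also have "\<dots> = infsum f UNIV - sum f F"
    using f F(1) by (subst infsum_Diff) (auto intro: summable_on_subset_banach)
  also have "\<dots> \<le> e\<^sup>2 / 2" using F(2) unfolding dist_real_def by linarith
  also have "\<dots> < e\<^sup>2" using assms by simp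
  finally have "norm y < e" using assms by (simp add: power2_less_imp_less)
  then show thesis using that F(1) unfolding y_def by blast
qed

text \<open>The dense set consists of the finite combinations of unit vectors with coefficients in a countable
  dense set of scalars. Encoding combinations by lists makes countability immediate and turns
  addition into concatenation.\<close>

lemma ell2_separable:
  obtains D :: "'a::countable ell2 set" where "countable D" "closure D = UNIV"
proof -
  obtain Q :: "complex set" where Q: "countable Q" "\<And>X. open X \<Longrightarrow> X \<noteq> {} \<Longrightarrow> \<exists>d\<in>Q. d \<in> X"
    by (rule countable_dense_setE) blast
  have Q_dense: "c \<in> closure Q" for c
    unfolding closure_approachable using Q(2)[of "ball c _"] by (force simp: dist_commute)
  define comb where "comb = (\<lambda>l. sum_list (map (\<lambda>(k, q). q *\<^sub>C (unit_vec k :: 'a ell2)) l))"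
  define D where "D = comb ` lists (UNIV \<times> Q)"
  have comb_append: "comb (l @ m) = comb l + comb m" for l m by (simp add: comb_def)
  have zero: "0 \<in> closure D"
    by (rule subsetD[OF closure_subset]) (auto simp: D_def comb_def intro!: image_eqI[of _ _ "[]"])
  have add: "x + y \<in> closure D" if x: "x \<in> closure D" and y: "y \<in> closure D" for x y
  proof -
    obtain f where f: "\<And>n. f n \<in> D" "f \<longlonglongrightarrow> x"
      using x unfolding closure_sequential by blast
    obtain g where g: "\<And>n. g n \<in> D" "g \<longlonglongrightarrow> y"
      using y unfolding closure_sequential by blast
    have "f n + g n \<in> D" for n
      using f(1)[of n] g(1)[of n] unfolding D_def by (force simp flip: comb_append)
    then show ?thesis
      unfolding closure_sequential using tendsto_add[OF f(2) g(2)]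
      by (intro exI[of _ "\<lambda>n. f n + g n"]) simp
  qed
  have scale: "c *\<^sub>C unit_vec k \<in> closure D" for c k
  proof -
    obtain q where q: "\<And>n. q n \<in> Q" "q \<longlonglongrightarrow> c"
      using Q_dense[of c] unfolding closure_sequential by blast
    have "q n *\<^sub>C unit_vec k \<in> D" for n
      unfolding D_def using q(1) by (intro image_eqI[of _ _ "[(k, q n)]"]) (auto simp: comb_def)
    then show ?thesis
      unfolding closure_sequential using tendsto_scaleC[OF q(2)]
      by (intro exI[of _ "\<lambda>n. q n *\<^sub>C unit_vec k"]) simp
  qed
  have sum: "(\<Sum>k\<in>F. c k *\<^sub>C unit_vec k) \<in> closure D" for c and F :: "'a set"
    by (induction F rule: infinite_finite_induct) (auto intro: zero add scale)
  have "x \<in> closure D" for x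
  proof -
    have "\<exists>y\<in>closure D. dist y x < e" if "e > 0" for e
      using finite_truncation_approximates[OF that, of x] sum
      by (metis dist_commute dist_norm)
    then have "x \<in> closure (closure D)" unfolding closure_approachable[of x "closure D"] by blast
    then show ?thesis by simp
  qed
  moreover have "countable D" unfolding D_def using Q(1) by (intro countable_image countable_lists) simp
  ultimately show thesis using that by blast
qed

text \<open>The squared norm is the supremum of its finite partial sums, of which there are countably many.\<close>

lemma borel_measurable_norm_of_weakly_measurable:
  fixes f :: "'m \<Rightarrow> 'a::countable ell2"
  assumes "\<And>v. (\<lambda>\<omega>. cinner (f \<omega>) v) \<in> borel_measurable M"
  shows "(\<lambda>\<omega>. norm (f \<omega>)) \<in> borel_measurable M"
proof -
  have [measurable]: "(\<lambda>\<omega>. ell2_apply (f \<omega>) k) \<in> borel_measurable M" for k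
    using assms[of "unit_vec k"] by (simp add: cinner_unit_vec)
  have "(\<lambda>\<omega>. (norm (f \<omega>))\<^sup>2) \<in> borel_measurable M"
    unfolding borel_measurable_iff_greater
  proof
    fix a :: real
    have eq: "a < (norm x)\<^sup>2 \<longleftrightarrow> (\<exists>F\<in>Collect finite. a < (\<Sum>k\<in>F. (cmod (ell2_apply x k))\<^sup>2))"
      for x :: "'a ell2"
    proof
      assume "a < (norm x)\<^sup>2"
      then show "\<exists>F\<in>Collect finite. a < (\<Sum>k\<in>F. (cmod (ell2_apply x k))\<^sup>2)"
        using infsum_le_finite_sums[OF ell2_apply_summable[of x], of a]
        unfolding norm_ell2_square by (force simp: not_less[symmetric])
    next
      assume "\<exists>F\<in>Collect finite. a < (\<Sum>k\<in>F. (cmod (ell2_apply x k))\<^sup>2)"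
      then show "a < (norm x)\<^sup>2"
        using finite_sum_le_infsum[OF ell2_apply_summable[of x]]
        unfolding norm_ell2_square by (force intro: less_le_trans)
    qed
    have "countable (Collect finite :: 'a set set)" by (rule countable_Collect_finite)
    then have "Measurable.pred M (\<lambda>\<omega>. \<exists>F\<in>Collect finite. a < (\<Sum>k\<in>F. (cmod (ell2_apply (f \<omega>) k))\<^sup>2))"
      by measurable
    then show "{\<omega> \<in> space M. a < (norm (f \<omega>))\<^sup>2} \<in> sets M" unfolding eq by (simp add: pred_def)
  qed
  then have "(\<lambda>\<omega>. sqrt ((norm (f \<omega>))\<^sup>2)) \<in> borel_measurable M" by measurable
  then show ?thesis by simp
qed

section \<open>Measurability of the spectrum\<close>

lemma linear_on_subspace_shift:
  assumes "linear_on_subspace V T"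
  shows "linear_on_subspace V (\<lambda>x. T x - z *\<^sub>C x)"
  using assms unfolding linear_on_subspace_def
  by (simp add: ell2.scale_right_distrib ell2.scale_right_diff_distrib mult.commute)

lemma linear_on_subspace_id: "linear_on_subspace V (\<lambda>x. x)"
  by (simp add: linear_on_subspace_def)

text \<open>From right to left, the approximate eigenvalues \<open>z n\<close> accumulate at some \<open>l \<in> B\<close>. If \<open>l\<close> were not an
  eigenvalue, then \<open>T - l\<close> would be bounded below on \<open>V\<close>, contradicting the approximate
  eigenvectors. From left to right, the strict inequality holds at an eigenvector for every \<open>z\<close>
  close to the eigenvalue, hence on an open set of vectors, which meets the dense set \<open>D\<close>.
  Strictness also keeps the approximate eigenvectors away from \<open>0\<close>.\<close>

lemma eigenvalue_in_compact_iff: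
  fixes V :: "'a ell2 set"
  assumes V: "finite_dim V" and T: "linear_on_subspace V T"
    and B: "compact B" and Q: "Q \<subseteq> B" "B \<subseteq> closure Q" and D: "closure D = UNIV"
  shows "eigenvalues_on V T \<inter> B \<noteq> {} \<longleftrightarrow>
    (\<forall>n. \<exists>z\<in>Q. \<exists>u\<in>D. norm (T (orth_proj V u) - z *\<^sub>C orth_proj V u)
        < inverse (real (Suc n)) * norm (orth_proj V u))"
    (is "?L \<longleftrightarrow> ?R")
proof
  assume ?L
  then obtain l x where l: "l \<in> B" and x: "x \<in> V" "x \<noteq> 0" "T x = l *\<^sub>C x"
    unfolding eigenvalues_on_def by blast
  show ?R
  proof
    fix n
    have "\<exists>z\<in>Q. dist z l < inverse (real (Suc n))"
      using l Q(2) unfolding closure_approachable subset_iff by simp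
    then obtain z where z: "z \<in> Q" "cmod (l - z) < inverse (real (Suc n))"
      by (auto simp: dist_norm norm_minus_commute)
    define g where "g = (\<lambda>u. norm (T (orth_proj V u) - z *\<^sub>C orth_proj V u)
        - inverse (real (Suc n)) * norm (orth_proj V u))"
    have "continuous_on UNIV g"
      unfolding g_def
      by (intro continuous_intros
          continuous_on_operator_orth_proj[OF V linear_on_subspace_shift[OF T]]
          continuous_on_operator_orth_proj[OF V linear_on_subspace_id])
    then have "open {u. g u < 0}"
      using open_Collect_less continuous_on_const by blast
    moreover have "g x < 0"
      using x z(2)
      by (simp add: g_def orth_proj_fixes[OF V] norm_scaleC flip: ell2.scale_left_diff_distrib)
    ultimately have "{u. g u < 0} \<inter> D \<noteq> {}"
      using D open_Int_closure_eq_empty[of "{u. g u < 0}" D] by auto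
    then show "\<exists>z\<in>Q. \<exists>u\<in>D. norm (T (orth_proj V u) - z *\<^sub>C orth_proj V u)
        < inverse (real (Suc n)) * norm (orth_proj V u)"
      using z(1) unfolding g_def by auto
  qed
next
  assume ?R
  then obtain z u where z: "\<And>n. z n \<in> Q"
    and u: "\<And>n. norm (T (orth_proj V (u n)) - z n *\<^sub>C orth_proj V (u n))
        < inverse (real (Suc n)) * norm (orth_proj V (u n))"
    by metis
  define x where "x n = orth_proj V (u n)" for n
  have x: "x n \<in> V" for n unfolding x_def by (rule orth_proj_in[OF V])
  obtain l r where l: "l \<in> B" and r: "strict_mono r" "(z \<circ> r) \<longlonglongrightarrow> l"
    using B z Q(1) unfolding compact_def by (metis subsetD)
  have "l \<in> eigenvalues_on V T"
  proof (rule ccontr)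
    assume "l \<notin> eigenvalues_on V T"
    then have "y = 0" if "y \<in> V" "T y - l *\<^sub>C y = 0" for y
      using that unfolding eigenvalues_on_def by auto
    then obtain K where K: "K > 0" "\<And>y. y \<in> V \<Longrightarrow> norm y \<le> K * norm (T y - l *\<^sub>C y)"
      using finite_dim_injective_bounded_below[OF V linear_on_subspace_shift[OF T]] by metis
    have ge: "1 \<le> K * (inverse (real (Suc (r n))) + cmod (z (r n) - l))" for n
    proof -
      define y where "y = x (r n)"
      have y: "norm (T y - z (r n) *\<^sub>C y) < inverse (real (Suc (r n))) * norm y"
        using u[of "r n"] by (simp add: y_def x_def)
      then have pos: "norm y > 0"
        using norm_ge_zero[of y] by (cases "norm y = 0") auto
      have "T y - l *\<^sub>C y = (T y - z (r n) *\<^sub>C y) + (z (r n) - l) *\<^sub>C y"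
        by (simp add: ell2.scale_left_diff_distrib)
      then have "norm (T y - l *\<^sub>C y) \<le> norm (T y - z (r n) *\<^sub>C y) + cmod (z (r n) - l) * norm y"
        by (metis norm_triangle_ineq norm_scaleC)
      also have "\<dots> \<le> (inverse (real (Suc (r n))) + cmod (z (r n) - l)) * norm y"
        using y by (simp add: distrib_right)
      finally have "K * norm (T y - l *\<^sub>C y)
          \<le> K * ((inverse (real (Suc (r n))) + cmod (z (r n) - l)) * norm y)"
        using K(1) by simp
      with K(2)[of y] x have
        "1 * norm y \<le> (K * (inverse (real (Suc (r n))) + cmod (z (r n) - l))) * norm y"
        by (simp add: y_def mult.assoc)
      then show ?thesis using pos by (rule mult_right_le_imp_le)
    qed
    have "(\<lambda>n. K * (inverse (real (Suc (r n))) + cmod (z (r n) - l))) \<longlonglongrightarrow> K * (0 + cmod (l - l))"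
      using LIMSEQ_subseq_LIMSEQ[OF LIMSEQ_inverse_real_of_nat r(1)] r(2)
      by (intro tendsto_intros) (simp_all add: o_def)
    then have "1 \<le> K * (0 + cmod (l - l))"
      by (rule LIMSEQ_le_const) (use ge in blast)
    then show False by simp
  qed
  then show ?L using l by blast
qed

lemma hit_measurable_eigenvalues:
  fixes J :: "'m \<Rightarrow> 'a::countable ell2 set"
  assumes J: "\<And>\<omega>. \<omega> \<in> space M \<Longrightarrow> finite_dim (J \<omega>)"
    and R: "\<And>\<omega>. \<omega> \<in> space M \<Longrightarrow> linear_on_subspace (J \<omega>) (R \<omega>)"
    and Jm: "\<And>u v. (\<lambda>\<omega>. cinner (orth_proj (J \<omega>) u) v) \<in> borel_measurable M"
    and Rm: "\<And>u v. (\<lambda>\<omega>. cinner (R \<omega> (orth_proj (J \<omega>) u)) v) \<in> borel_measurable M"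
  shows "hit_measurable M (\<lambda>\<omega>. eigenvalues_on (J \<omega>) (R \<omega>))"
proof -
  obtain D :: "'a ell2 set" where D: "countable D" "closure D = UNIV" by (rule ell2_separable)
  have compact_hit: "Measurable.pred M (\<lambda>\<omega>. eigenvalues_on (J \<omega>) (R \<omega>) \<inter> B \<noteq> {})"
    if B: "compact B" for B
  proof -
    obtain Q where Q: "countable Q" "Q \<subseteq> B" "B \<subseteq> closure Q" by (rule separable)
    have [measurable]: "(\<lambda>\<omega>. norm (orth_proj (J \<omega>) u)) \<in> borel_measurable M" for u
      by (rule borel_measurable_norm_of_weakly_measurable[OF Jm])
    have [measurable]: "(\<lambda>\<omega>. norm (R \<omega> (orth_proj (J \<omega>) u) - z *\<^sub>C orth_proj (J \<omega>) u))
        \<in> borel_measurable M" for u z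
    proof (rule borel_measurable_norm_of_weakly_measurable)
      note [measurable] = Jm Rm
      show "(\<lambda>\<omega>. cinner (R \<omega> (orth_proj (J \<omega>) u) - z *\<^sub>C orth_proj (J \<omega>) u) v)
          \<in> borel_measurable M" for v
        unfolding cinner_diff_left cinner_scaleC_left by measurable
    qed
    have "Measurable.pred M (\<lambda>\<omega>. \<forall>n. \<exists>z\<in>Q. \<exists>u\<in>D.
        norm (R \<omega> (orth_proj (J \<omega>) u) - z *\<^sub>C orth_proj (J \<omega>) u)
        < inverse (real (Suc n)) * norm (orth_proj (J \<omega>) u))"
      using Q(1) D(1) by measurable
    then show ?thesis
      by (subst measurable_cong) (rule eigenvalue_in_compact_iff[OF J R B Q(2,3) D(2)])
  qed
  show ?thesis
    unfolding hit_measurable_def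
  proof (intro allI impI)
    fix U :: "complex set" assume "open U"
    then obtain C where C: "countable C" "\<And>X. X \<in> C \<Longrightarrow> \<exists>a b. X = cbox a b" "\<Union>C = U"
      by (rule open_countable_Union_open_cbox) blast
    have C_compact: "compact X" if "X \<in> C" for X using C(2)[OF that] compact_cbox by metis
    have "Measurable.pred M (\<lambda>\<omega>. \<exists>X\<in>C. eigenvalues_on (J \<omega>) (R \<omega>) \<inter> X \<noteq> {})"
      unfolding pred_def
      by (rule sets.sets_Collect_countable_Ex'[OF _ C(1)])
        (use C_compact compact_hit in \<open>auto simp: pred_def\<close>)
    moreover have "(\<exists>X\<in>C. T \<inter> X \<noteq> {}) \<longleftrightarrow> T \<inter> U \<noteq> {}" for T
      using C(3) by blast
    ultimately show "Measurable.pred M (\<lambda>\<omega>. eigenvalues_on (J \<omega>) (R \<omega>) \<inter> U \<noteq> {})" by simp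
  qed
qed

lemma eigenvalue_le_op_norm:
  assumes V: "ell2.subspace V" and C: "op_norm_on V T \<le> ereal C" and T: "linear_on_subspace V T"
    and l: "l \<in> eigenvalues_on V T"
  shows "cmod l \<le> C"
proof -
  obtain x where x: "x \<in> V" "x \<noteq> 0" "T x = l *\<^sub>C x" using l by (auto simp: eigenvalues_on_def)
  define c where "c = complex_of_real (inverse (norm x))"
  have y: "c *\<^sub>C x \<in> V" "norm (c *\<^sub>C x) = 1"
    using x ell2.subspace_scale[OF V] by (auto simp: c_def norm_scaleC norm_inverse)
  have "T (c *\<^sub>C x) = l *\<^sub>C (c *\<^sub>C x)"
    using T x(1,3) unfolding linear_on_subspace_def by (simp add: mult.commute)
  then have "ereal (cmod l) = ereal (norm (T (c *\<^sub>C x)))"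
    using y(2) norm_scaleC[of l "c *\<^sub>C x"] by simp
  also have "\<dots> \<le> op_norm_on V T"
    unfolding op_norm_on_def using y by (intro SUP_upper) simp
  also note C
  finally show ?thesis by simp
qed

theorem theorem5p5:
  fixes J :: "real ^ 'd \<Rightarrow> (int ^ 'd) ell2 set"
    and R :: "real ^ 'd \<Rightarrow> (int ^ 'd) ell2 \<Rightarrow> (int ^ 'd) ell2"
  assumes "measurable_range_function J"
    and "AE \<omega> in cube_measure. finite_dim (J \<omega>)"
    and "measurable_range_operator J R"
    and "bounded_range_operator J R"
    and "AE \<omega> in cube_measure. R \<omega> ` J \<omega> \<subseteq> J \<omega>"
  shows "\<exists>ev :: nat \<Rightarrow> real ^ 'd \<Rightarrow> complex.
    (\<forall>j\<ge>1. ev j \<in> L_infinity) \<and>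
    (\<forall>j\<ge>1. \<forall>j'\<ge>1. j \<noteq> j' \<longrightarrow> (AE \<omega> in cube_measure. ev j \<omega> \<noteq> ev j' \<omega>)) \<and>
    (\<forall>n\<ge>1. \<forall>i\<in>{1..n}. AE \<omega> in cube_measure.
       \<omega> \<in> dim_eig_set J R n i \<longrightarrow> eigenvalues_on (J \<omega>) (R \<omega>) = (\<lambda>j. ev j \<omega>) ` {1..i})"
proof -
  obtain C where "AE \<omega> in cube_measure. op_norm_on (J \<omega>) (R \<omega>) \<le> ereal C"
    using assms(4) unfolding bounded_range_operator_def by blast
  moreover have "AE \<omega> in cube_measure. linear_on_subspace (J \<omega>) (R \<omega>)"
    using assms(3) unfolding measurable_range_operator_def range_operator_def bounded_operator_on_def
    by auto
  ultimately have "AE \<omega> in cube_measure. finite_dim (J \<omega>) \<and> linear_on_subspace (J \<omega>) (R \<omega>) \<and>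
      op_norm_on (J \<omega>) (R \<omega>) \<le> ereal C"
    using assms(2) by auto
  then obtain N where
    N: "{\<omega> \<in> space cube_measure. \<not> (finite_dim (J \<omega>) \<and> linear_on_subspace (J \<omega>) (R \<omega>) \<and>
      op_norm_on (J \<omega>) (R \<omega>) \<le> ereal C)} \<subseteq> N" "emeasure cube_measure N = 0" "N \<in> sets cube_measure"
    by (rule AE_E)
  have AE_N: "AE \<omega> in cube_measure. \<omega> \<notin> N"
    using N(2,3) by (intro AE_not_in) (auto simp: null_sets_def)
  \<comment> \<open>On the null set the operator is replaced by the one on the zero space, which has no eigenvalues.\<close>
  define J' where "J' \<omega> = (if \<omega> \<in> N then {0} else J \<omega>)" for \<omega>
  define R' where "R' \<omega> = (if \<omega> \<in> N then (\<lambda>x. x) else R \<omega>)" for \<omega>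
  define S where "S \<omega> = eigenvalues_on (J' \<omega>) (R' \<omega>)" for \<omega>
  have fin0: "finite_dim ({0} :: (int ^ 'd) ell2 set)"
    unfolding finite_dim_def by (intro exI[of _ "{}"]) simp
  have proj0: "orth_proj {0} u = 0" for u :: "(int ^ 'd) ell2"
    using orth_proj_in[OF fin0] by simp
  have J': "finite_dim (J' \<omega>)" and R': "linear_on_subspace (J' \<omega>) (R' \<omega>)"
    if "\<omega> \<in> space cube_measure" for \<omega>
    using N(1) that fin0 by (auto simp: J'_def R'_def linear_on_subspace_id)
  have S_bound: "cmod l \<le> C" if "\<omega> \<in> space cube_measure" "l \<in> S \<omega>" for \<omega> l
  proof -
    have "\<omega> \<notin> N" using that(2) by (auto simp: S_def J'_def eigenvalues_on_def)
    then show ?thesis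
      using that N(1) eigenvalue_le_op_norm[of "J \<omega>" "R \<omega>" C l] finite_dim_subspace[of "J \<omega>"]
      by (auto simp: S_def J'_def R'_def)
  qed
  have S_hit: "hit_measurable cube_measure S"
    unfolding S_def
  proof (rule hit_measurable_eigenvalues[OF J' R'])
    fix u v :: "(int ^ 'd) ell2"
    have [measurable]: "N \<in> sets cube_measure" by (rule N(3))
    have [measurable]: "(\<lambda>\<omega>. cinner (orth_proj (J \<omega>) u) v) \<in> borel_measurable cube_measure"
      "(\<lambda>\<omega>. cinner (R \<omega> (orth_proj (J \<omega>) u)) v) \<in> borel_measurable cube_measure"
      using assms(1,3) unfolding measurable_range_function_def measurable_range_operator_def by auto
    have "cinner (orth_proj (J' \<omega>) u) v = (if \<omega> \<in> N then 0 else cinner (orth_proj (J \<omega>) u) v)"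
      "cinner (R' \<omega> (orth_proj (J' \<omega>) u)) v =
        (if \<omega> \<in> N then 0 else cinner (R \<omega> (orth_proj (J \<omega>) u)) v)" for \<omega>
      by (auto simp: J'_def R'_def proj0)
    then show "(\<lambda>\<omega>. cinner (orth_proj (J' \<omega>) u) v) \<in> borel_measurable cube_measure"
      "(\<lambda>\<omega>. cinner (R' \<omega> (orth_proj (J' \<omega>) u)) v) \<in> borel_measurable cube_measure"
      by simp_all
  qed
  obtain K :: "nat \<Rightarrow> complex set" where K: "basis_seq K" using basis_seq_exists by blast
  \<comment> \<open>Default values outside the disc of radius C, bounded and pairwise distinct.\<close>
  define c where "c j = complex_of_real (\<bar>C\<bar> + 1 + inverse (real (Suc j)))" for j
  have c_norm: "cmod (c j) = \<bar>C\<bar> + 1 + inverse (real (Suc j))" for j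
    unfolding c_def norm_of_real by (simp add: add_nonneg_nonneg)
  have c_inj: "inj c" by (rule injI) (simp add: c_def)
  have c_out: "range c \<inter> S \<omega> = {}" if "\<omega> \<in> space cube_measure" for \<omega>
  proof -
    have "C < cmod (c j)" for j
      unfolding c_norm using abs_ge_self[of C] positive_imp_inverse_positive[of "real (Suc j)"]
      by linarith
    then show ?thesis using S_bound[OF that] by (force simp: not_less[symmetric])
  qed
  \<comment> \<open>The enumeration starts at 0, the functions in the conclusion are numbered from 1.\<close>
  define ev where "ev j \<omega> = nth_pick K c (S \<omega>) (j - 1)" for j \<omega>
  have ev_L: "ev j \<in> L_infinity" for j
    unfolding L_infinity_def
  proof (intro CollectI conjI exI[of _ "\<bar>C\<bar> + 2"] AE_I2)
    show "ev j \<in> borel_measurable cube_measure"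
      unfolding ev_def by (rule nth_pick_measurable[OF K S_hit])
    fix \<omega> :: "real ^ 'd" assume "\<omega> \<in> space cube_measure"
    moreover have "cmod (c (j - 1)) \<le> \<bar>C\<bar> + 2"
      unfolding c_norm by (simp add: inverse_le_1_iff)
    ultimately show "cmod (ev j \<omega>) \<le> \<bar>C\<bar> + 2"
      using nth_pick_in_or_default[of K c "S \<omega>" "j - 1"] S_bound[of \<omega> "ev j \<omega>"]
      unfolding ev_def by fastforce
  qed
  have ev_distinct: "ev j \<omega> \<noteq> ev j' \<omega>"
    if "\<omega> \<in> space cube_measure" "j \<ge> 1" "j' \<ge> 1" "j \<noteq> j'" for j j' \<omega>
    using injD[OF inj_nth_pick[OF c_inj c_out[OF that(1)]], of K "j - 1" "j' - 1"] that(2-)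
    unfolding ev_def by auto
  have ev_image: "eigenvalues_on (J \<omega>) (R \<omega>) = (\<lambda>j. ev j \<omega>) ` {1..i}"
    if "\<omega> \<in> space cube_measure" "\<omega> \<notin> N" "\<omega> \<in> dim_eig_set J R n i" for \<omega> n i
  proof -
    have S: "S \<omega> = eigenvalues_on (J \<omega>) (R \<omega>)" using that(2) by (simp add: S_def J'_def R'_def)
    then have "finite (S \<omega>)" "card (S \<omega>) = i" using that(3) by (auto simp: dim_eig_set_def)
    then have "nth_pick K c (S \<omega>) ` {..<i} = S \<omega>"
      using nth_pick_image[OF K c_inj c_out[OF that(1)]] by simp
    moreover have "{..<i} = (\<lambda>j. j - 1) ` {1..i}"
      by (auto intro!: image_eqI[of _ _ "Suc _"])
    ultimately show ?thesis using S unfolding ev_def by (simp add: image_image)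
  qed
  show ?thesis
  proof (intro exI[of _ ev] conjI allI ballI impI)
    show "ev j \<in> L_infinity" for j by (rule ev_L)
    show "AE \<omega> in cube_measure. ev j \<omega> \<noteq> ev j' \<omega>" if "1 \<le> j" "1 \<le> j'" "j \<noteq> j'" for j j'
      using ev_distinct that by (intro AE_I2) blast
    show "AE \<omega> in cube_measure. \<omega> \<in> dim_eig_set J R n i \<longrightarrow>
        eigenvalues_on (J \<omega>) (R \<omega>) = (\<lambda>j. ev j \<omega>) ` {1..i}" for n i
      using AE_N AE_space by eventually_elim (use ev_image in blast)
  qed
qed

end
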